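(* None of the following five assertions (taken from the literature) is correct. In every assertion, $N \geq 2$ is an integer, $C \subset \mathbb{R}^n$ is a nonempty closed convex set, $f_1,\dots,f_N : C\times C \to \mathbb{R}$ are bifunctions with $\Omega := \bigcap_{i=1}^N Sol(C,f_i) \neq \emptyset$, and $\alpha_1,\dots,\alpha_N \in (0,1)$ with $\sum_{i=1}^N \alpha_i = 1$. In Assertions 1–4 each $f_i$ is assumed to satisfy $(\mathcal{A}_1)$–$(\mathcal{A}_4)$; in Assertion 5 each $f_i$ is assumed to satisfy $(\mathcal{A}_1)$–$(\mathcal{A}_5)$ (conditions stated in the context). **Assertion 1.** $\Omega = Sol\big(C, \sum_{i=1}^N \alpha_i f_i\big)$. **Assertion 2.** Let $F$ be a $\tau$-contractive mapping on $\mathbb{R}^n$, let $A$ be a strongly positive bounded linear operator on $\mathbb{R}^n$ with coefficient $\bar\gamma$, and let $0 < \gamma < \bar\gamma/\tau$. Let $\{x^k\}, \{y^k\}, \{z^k\}$ be generated by $x^1 \in \mathbb{R}^n$ and, for $k \geq 1$, $$\begin{cases} \sum_{i=1}^N \alpha_i f_i(z^k,y) + \frac{1}{\rho_k}\langle y - z^k, z^k - x^k\rangle \geq 0 \quad \forall y \in C,\\ y^k = \theta_k P_C(x^k) + (1-\theta_k) z^k,\\ x^{k+1} = \delta_k \gamma F(x^k) + (I - \delta_k A) y^k,\end{cases}$$ with $z^k \in C$, where $\{\delta_k\}, \{\theta_k\}, \{\rho_k\} \subset (0,1)$. Suppose: (i) $\lim_{k\to\infty} \delta_k = 0$ and $\sum_{k=1}^\infty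 \delta_k = \infty$; (ii) $0 < \underline\theta \leq \theta_k \leq \bar\theta < 1$ for some $\underline\theta, \bar\theta \in (0,1)$; (iii) $0 < \underline\alpha \leq \alpha_i \leq \bar\alpha < 1$ for some $\underline\alpha,\bar\alpha \in (0,1)$; (iv) $\sum_{i=1}^N \alpha_i = 1$; (v) $\sum_{k=1}^\infty |\delta_{k+1}-\delta_k| < \infty$, $\sum_{k=1}^\infty |\theta_{k+1}-\theta_k| < \infty$, $\sum_{k=1}^\infty |\rho_{k+1}-\rho_k| < \infty$. Then $\{x^k\}$, $\{y^k\}$ and $\{z^k\}$ converge to $q = P_\Omega(I - A + \gamma F) q$. **Assertion 3.** Let $\{x^k\}$ and $\{y^k\}$ be generated by $u, x^1 \in \mathbb{R}^n$ and, for $k\ge 1$, $$\begin{cases} \sum_{i=1}^N \alpha_i f_i(y^k,y) + \frac{1}{\rho_k}\langle y - y^k, y^k - x^k\rangle \geq 0 \quad \forall y \in C,\\ x^{k+1} = \lambda_k u + \mu_k x^k + \delta_k y^k,\end{cases}$$ with $y^k \in C$, where $\{\lambda_k\}, \{\mu_k\}, \{\delta_k\} \subset (0,1)$, $\lambda_k + \mu_k + \delta_k = 1$, and $\{\rho_k\} \subset (\underline\rho, \bar\rho) \subset (0,1)$. Suppose: (i) $\lim_{k\to\infty} \lambda_k = 0$ and $\sum_{k=1}^\infty \lambda_k = \infty$; (ii) $\sum_{i=1}^N \alpha_i = 1$; (iii) $\sum_{k=1}^\infty |\delta_{k+1}-\delta_k| < \infty$. Then $\{x^k\}$ and $\{y^k\}$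 converge to $q = P_\Omega(u)$. **Assertion 4.** Let $F$ be a $\tau$-contractive mapping on $\mathbb{R}^n$. Let $\{x^k\}$ and $\{y^k\}$ be generated by $x^1 \in C$ and, for $k\ge 1$, $$\begin{cases} \sum_{i=1}^N \alpha_i f_i(y^k,y) + \frac{1}{\rho_k}\langle y - y^k, y^k - x^k\rangle \geq 0 \quad \forall y \in C,\\ x^{k+1} = \lambda_k F(x^k) + \mu_k x^k + \delta_k y^k,\end{cases}$$ with $y^k \in C$, where $\{\lambda_k\}, \{\mu_k\}, \{\delta_k\} \subset (0,1)$ and $\{\rho_k\} \subset (\underline\rho, \bar\rho) \subset (0,1)$. Suppose: (i) $\lim_{k\to\infty} \lambda_k = 0$ and $\sum_{k=1}^\infty \lambda_k = \infty$; (ii) $\sum_{i=1}^N \alpha_i = 1$; (iii) $\sum_{k=1}^\infty |\rho_{k+1}-\rho_k| < \infty$. Then $\{x^k\}$ and $\{y^k\}$ converge to $q = P_\Omega(u)$. **Assertion 5.** For given $x^0, x^1 \in \mathbb{R}^n$, let $\{x^k\}$, $\{y^k\}$ and $\{z^k\}$ be generated, for $k\ge 1$, by $$\begin{cases} y^k = x^k + \theta_k (x^k - x^{k-1}),\\ \sum_{i=1}^N \alpha_i f_i(z^k,y) + \frac{1}{\rho_k}\langle y - z^k, z^k - y^k\rangle \geq 0 \quad \forall y \in C,\\ x^{k+1} = \lambda_k x^k + \mu_k z^k,\end{cases}$$ with $z^k \in C$, where $\{\theta_k\} \subset [0,\theta]$, $\theta \in [0,1]$, $\{\lambda_k\}, \{\mu_k\}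 \subset (0,1)$ with $\lambda_k + \mu_k = 1$ for all $k$, and $\{\rho_k\} \subset (\underline\rho, \bar\rho) \subset (0,1)$. Suppose: (i) $\sum_{k=1}^\infty \theta_k \|x^k - x^{k-1}\| < \infty$; (ii) $\sum_{i=1}^\infty \alpha_i < \infty$ and $\lim_{i\to\infty} \alpha_i = 0$; (iii) $\sum_{k=1}^\infty |\rho_{k+1}-\rho_k| < \infty$ and $\sum_{k=1}^\infty |\lambda_{k+1}-\lambda_k| < \infty$. Then $\{x^k\}$ converges to $q = P_\Omega(u)$.
   Context: For a nonempty closed convex set $C \subset \mathbb{R}^n$ (Euclidean space) and a bifunction $f : C \times C \to \mathbb{R}$, $Sol(C,f) := \{x^* \in C : f(x^*, y) \geq 0 \text{ for all } y \in C\}$. The bifunction $\sum_{i=1}^N \alpha_i f_i$ is defined pointwise. $P_K$ denotes the metric (nearest-point) projection onto a nonempty closed convex set $K \subset \mathbb{R}^n$, and $I$ is the identity. A map $F:\mathbb{R}^n\to\mathbb{R}^n$ is $\tau$-contractive, with $\tau \in (0,1)$, if $\|F(x)-F(y)\| \leq \tau\|x-y\|$ for all $x,y$. A linear operator $A$ on $\mathbb{R}^n$ is strongly positive with coefficient $\bar\gamma > 0$ if $\langle Ax, x\rangle \geq \bar\gamma \|x\|^2$ for all $x$. Conditions on a bifunction $\varphi : C \times C \to \mathbb{R}$: $(\mathcal{A}_1)$ $\varphi(x,x) = 0$ for every $x \in C$; $(\mathcal{A}_2)$ $\varphi$ is monotone on $C$, i.e. $\varphi(x,y) + \varphi(y,x)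 \leq 0$ for all $x,y \in C$; $(\mathcal{A}_3)$ $\varphi$ is upper hemicontinuous: for all $x,y,z \in C$, $\limsup_{t \to 0^+} \varphi(tz + (1-t)x, y) \leq \varphi(x,y)$; $(\mathcal{A}_4)$ for each $x \in C$, $\varphi(x, \cdot)$ is lower semicontinuous and convex on $C$; $(\mathcal{A}_5)$ for fixed $r > 0$ and $z \in C$ there exist a nonempty compact convex set $B \subset \mathbb{R}^n$ and $x \in C \cap B$ such that $\varphi(y,x) + \frac{1}{r}\langle y - z, z - x\rangle < 0$ for all $y \in C \setminus B$. The assertions are reproduced as the source formulates them. In particular, in Assertions 4 and 5 the source writes the limit as $P_\Omega(u)$ without specifying the point $u$ (in any case $P_\Omega(u)$ is a point of $\Omega$), and in Assertion 5 it imposes condition (ii) although only the finite family $\alpha_1,\dots,\alpha_N$ has been introduced; it does not specify $\alpha_i$ for $i>N$. *)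

theory Defs
  imports "HOL-Analysis.Analysis"
begin

section \<open>The Euclidean spaces of all dimensions inside one inner product space\<close>

text \<open>
  The assertions below quantify over the dimension \<open>n\<close>, which a type-indexed space such as
  \<open>real ^ 'n\<close> does not allow inside a formula.  We therefore realise each space of dimension \<open>n\<close>
  as the subspace \<open>Rn n\<close> of sequences supported in \<open>{..<n}\<close> of the inner product space \<open>fseq\<close> of
  finitely supported real sequences.  On \<open>Rn n\<close> the inner product, hence the norm and the topology,
  are the Euclidean ones (\<open>inner_Rn\<close>), and \<open>Rn n\<close> is closed in \<open>fseq\<close> (\<open>closed_Rn\<close>), so the
  library notions \<open>closed\<close>, \<open>compact\<close>, \<open>convex\<close> and convergence mean for subsets of \<open>Rn n\<close> what
  they mean in the Euclidean space itself.
\<close>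

typedef fseq = "{v :: nat \<Rightarrow> real. finite {i. v i \<noteq> 0}}"
  morphisms coord Abs_fseq
  by (rule exI[of _ "\<lambda>_. 0"]) simp

setup_lifting type_definition_fseq

lemma finite_coord: "finite {i. coord x i \<noteq> 0}"
  using coord[of x] by simp

lemma fseq_eqI: "(\<And>i. coord x i = coord y i) \<Longrightarrow> x = y"
  by (simp add: coord_inject[symmetric] fun_eq_iff)

instantiation fseq :: real_vector
begin

lift_definition zero_fseq :: fseq is "\<lambda>_. 0" by simp

lift_definition plus_fseq :: "fseq \<Rightarrow> fseq \<Rightarrow> fseq" is "\<lambda>u v i. u i + v i"
  subgoal for u v
    by (rule finite_subset[of _ "{i. u i \<noteq> 0} \<union> {i. v i \<noteq> 0}"]) auto
  done

lift_definition uminus_fseq :: "fseq \<Rightarrow> fseq" is "\<lambda>v i. - v i" by simp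

lift_definition minus_fseq :: "fseq \<Rightarrow> fseq \<Rightarrow> fseq" is "\<lambda>u v i. u i - v i"
  subgoal for u v
    by (rule finite_subset[of _ "{i. u i \<noteq> 0} \<union> {i. v i \<noteq> 0}"]) auto
  done

lift_definition scaleR_fseq :: "real \<Rightarrow> fseq \<Rightarrow> fseq" is "\<lambda>c v i. c * v i"
  by (rule finite_subset) auto

instance
  by standard (transfer; simp add: fun_eq_iff algebra_simps)+

end

lemma coord_simps [simp]:
  "coord 0 i = 0" "coord (x + y) i = coord x i + coord y i" "coord (- x) i = - coord x i"
  "coord (x - y) i = coord x i - coord y i" "coord (c *\<^sub>R x) i = c * coord x i"
  by (transfer; simp)+

instantiation fseq :: real_inner
begin

definition inner_fseq :: "fseq \<Rightarrow> fseq \<Rightarrow> real" where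
  "inner_fseq x y = (\<Sum>i | coord x i \<noteq> 0. coord x i * coord y i)"

definition norm_fseq :: "fseq \<Rightarrow> real" where
  "norm_fseq x = sqrt (inner x x)"

definition dist_fseq :: "fseq \<Rightarrow> fseq \<Rightarrow> real" where
  "dist_fseq x y = norm (x - y)"

definition sgn_fseq :: "fseq \<Rightarrow> fseq" where
  "sgn_fseq x = x /\<^sub>R norm x"

definition uniformity_fseq :: "(fseq \<times> fseq) filter" where
  "uniformity_fseq = (INF e\<in>{0<..}. principal {(x, y). dist x y < e})"

definition open_fseq :: "fseq set \<Rightarrow> bool" where
  "open_fseq U = (\<forall>x\<in>U. \<forall>\<^sub>F (x', y) in uniformity. x' = x \<longrightarrow> y \<in> U)"

lemma inner_fseq_superset:
  assumes "finite S" "{i. coord x i \<noteq> 0} \<subseteq> S"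
  shows "inner x y = (\<Sum>i\<in>S. coord x i * coord y i)"
  unfolding inner_fseq_def by (rule sum.mono_neutral_left) (use assms in auto)

instance
proof
  fix x y z :: fseq and r :: real
  let ?S = "{i. coord x i \<noteq> 0} \<union> {i. coord y i \<noteq> 0}"
  have fin: "finite ?S" by (simp add: finite_coord)
  show "inner x y = inner y x"
    using inner_fseq_superset[OF fin, of x y] inner_fseq_superset[OF fin, of y x]
    by (simp add: mult.commute)
  have "{i. coord (x + y) i \<noteq> 0} \<subseteq> ?S" by auto
  then show "inner (x + y) z = inner x z + inner y z"
    using inner_fseq_superset[OF fin, of x z] inner_fseq_superset[OF fin, of y z]
      inner_fseq_superset[OF fin, of "x + y" z]
    by (simp add: sum.distrib[symmetric] algebra_simps)
  have "{i. coord (r *\<^sub>R x) i \<noteq> 0} \<subseteq> {i. coord x i \<noteq> 0}" by auto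
  from inner_fseq_superset[OF finite_coord this] show "inner (r *\<^sub>R x) y = r * inner x y"
    by (simp add: inner_fseq_def sum_distrib_left mult.assoc)
  show "0 \<le> inner x x"
    by (simp add: inner_fseq_def sum_nonneg)
  show "inner x x = 0 \<longleftrightarrow> x = 0"
  proof
    assume "inner x x = 0"
    then have "\<forall>i\<in>{i. coord x i \<noteq> 0}. coord x i * coord x i = 0"
      by (subst sum_nonneg_eq_0_iff[symmetric]) (auto simp: inner_fseq_def finite_coord)
    then show "x = 0" by (intro fseq_eqI) auto
  qed (simp add: inner_fseq_def)
qed (simp_all add: norm_fseq_def dist_fseq_def sgn_fseq_def uniformity_fseq_def open_fseq_def)

end

definition Rn :: "nat \<Rightarrow> fseq set" where
  "Rn n = {x. \<forall>i\<ge>n. coord x i = 0}"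

lemma subspace_Rn: "subspace (Rn n)"
  by (auto simp: subspace_def Rn_def)

lemma bij_betw_Rn: "bij_betw (\<lambda>x. restrict (coord x) {..<n}) (Rn n) ({..<n} \<rightarrow>\<^sub>E UNIV)"
proof (rule bij_betw_byWitness[where f' = "\<lambda>v. Abs_fseq (\<lambda>i. if i < n then v i else 0)"])
  have fin: "finite {i. (if i < n then v i else 0) \<noteq> (0::real)}" for v
    by (rule finite_subset[of _ "{..<n}"]) (auto split: if_splits)
  then have [simp]:
    "coord (Abs_fseq (\<lambda>i. if i < n then v i else 0)) = (\<lambda>i. if i < n then v i else 0)" for v
    by (simp add: Abs_fseq_inverse)
  show "\<forall>x\<in>Rn n. Abs_fseq (\<lambda>i. if i < n then restrict (coord x) {..<n} i else 0) = x"
    using fin by (auto intro!: fseq_eqI simp: Rn_def Abs_fseq_inverse)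
  show "\<forall>v\<in>{..<n} \<rightarrow>\<^sub>E UNIV.
      restrict (coord (Abs_fseq (\<lambda>i. if i < n then v i else 0))) {..<n} = v"
    by (auto simp: fun_eq_iff PiE_def extensional_def)
  show "(\<lambda>v. Abs_fseq (\<lambda>i. if i < n then v i else 0)) ` ({..<n} \<rightarrow>\<^sub>E UNIV) \<subseteq> Rn n"
    by (rule image_subsetI) (simp add: Rn_def)
  show "(\<lambda>x. restrict (coord x) {..<n}) ` Rn n \<subseteq> {..<n} \<rightarrow>\<^sub>E UNIV"
    by (rule image_subsetI) (simp add: restrict_PiE_iff)
qed

lemma inner_Rn:
  assumes "x \<in> Rn n"
  shows "inner x y = (\<Sum>i<n. coord x i * coord y i)"
proof (rule inner_fseq_superset)
  have "i < n" if "coord x i \<noteq> 0" for i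
    using assms that by (cases "i < n") (simp_all add: Rn_def)
  then show "{i. coord x i \<noteq> 0} \<subseteq> {..<n}" by blast
qed simp

lemma closed_Rn: "closed (Rn n)"
proof -
  define e where "e i = Abs_fseq (\<lambda>j. if j = i then 1 else 0)" for i
  have "coord (e i) = (\<lambda>j. if j = i then 1 else 0)" for i
    by (simp add: e_def Abs_fseq_inverse)
  then have "inner (e i) x = coord x i" for i x
    by (subst inner_fseq_superset[of "{i}"]) auto
  then have "Rn n = (\<Inter>i\<in>{n..}. {x. inner (e i) x = 0})"
    by (auto simp: Rn_def)
  then show ?thesis
    by (simp only:) (intro closed_INT ballI closed_Collect_eq continuous_intros)
qed


section \<open>Equilibrium problems\<close>

text \<open>
  A bifunction \<open>C \<times> C \<rightarrow> \<real>\<close> is represented by a total function \<open>fseq \<Rightarrow> fseq \<Rightarrow> real\<close>, and a map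
  of the space by a total function \<open>fseq \<Rightarrow> fseq\<close>; only the values on \<open>C \<times> C\<close>, respectively on
  \<open>Rn n\<close>, enter the definitions.
\<close>

definition Sol :: "'a set \<Rightarrow> ('a \<Rightarrow> 'a \<Rightarrow> real) \<Rightarrow> 'a set" where
  "Sol C \<phi> = {x \<in> C. \<forall>y\<in>C. \<phi> x y \<ge> 0}"

definition comb :: "nat \<Rightarrow> (nat \<Rightarrow> real) \<Rightarrow> (nat \<Rightarrow> 'a \<Rightarrow> 'a \<Rightarrow> real) \<Rightarrow> 'a \<Rightarrow> 'a \<Rightarrow> real" where
  "comb N \<alpha> f x y = (\<Sum>i=1..N. \<alpha> i * f i x y)"

text \<open>
  The library's \<open>closest_point\<close> requires the class \<open>heine_borel\<close>, of which \<open>fseq\<close> is not an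
  instance.
\<close>

definition metric_proj :: "'a::metric_space set \<Rightarrow> 'a \<Rightarrow> 'a" where
  "metric_proj K u = (THE p. p \<in> K \<and> (\<forall>y\<in>K. dist u p \<le> dist u y))"

definition lsc_on :: "'a::topological_space set \<Rightarrow> ('a \<Rightarrow> real) \<Rightarrow> bool" where
  "lsc_on C g \<longleftrightarrow> (\<forall>y\<in>C. ereal (g y) \<le> Liminf (at y within C) (\<lambda>w. ereal (g w)))"

definition condA1 :: "'a set \<Rightarrow> ('a \<Rightarrow> 'a \<Rightarrow> real) \<Rightarrow> bool" where
  "condA1 C \<phi> \<longleftrightarrow> (\<forall>x\<in>C. \<phi> x x = 0)"

definition condA2 :: "'a set \<Rightarrow> ('a \<Rightarrow> 'a \<Rightarrow> real) \<Rightarrow> bool" where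
  "condA2 C \<phi> \<longleftrightarrow> (\<forall>x\<in>C. \<forall>y\<in>C. \<phi> x y + \<phi> y x \<le> 0)"

definition condA3 :: "'a::real_vector set \<Rightarrow> ('a \<Rightarrow> 'a \<Rightarrow> real) \<Rightarrow> bool" where
  "condA3 C \<phi> \<longleftrightarrow> (\<forall>x\<in>C. \<forall>y\<in>C. \<forall>z\<in>C.
     Limsup (at_right 0) (\<lambda>t::real. ereal (\<phi> (t *\<^sub>R z + (1 - t) *\<^sub>R x) y)) \<le> ereal (\<phi> x y))"

definition condA4 :: "'a::real_normed_vector set \<Rightarrow> ('a \<Rightarrow> 'a \<Rightarrow> real) \<Rightarrow> bool" where
  "condA4 C \<phi> \<longleftrightarrow> (\<forall>x\<in>C. lsc_on C (\<phi> x) \<and> convex_on C (\<phi> x))"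

definition condA5 :: "nat \<Rightarrow> fseq set \<Rightarrow> (fseq \<Rightarrow> fseq \<Rightarrow> real) \<Rightarrow> bool" where
  "condA5 n C \<phi> \<longleftrightarrow> (\<forall>r>0. \<forall>z\<in>C. \<exists>B. B \<subseteq> Rn n \<and> B \<noteq> {} \<and> compact B \<and> convex B \<and>
     (\<exists>x\<in>C \<inter> B. \<forall>y\<in>C - B. \<phi> y x + (1 / r) * inner (y - z) (z - x) < 0))"

definition condA1_4 :: "fseq set \<Rightarrow> (fseq \<Rightarrow> fseq \<Rightarrow> real) \<Rightarrow> bool" where
  "condA1_4 C \<phi> \<longleftrightarrow> condA1 C \<phi> \<and> condA2 C \<phi> \<and> condA3 C \<phi> \<and> condA4 C \<phi>"

text \<open>\<open>z\<close> solves the regularised equilibrium problem with parameter \<open>r\<close> at the point \<open>x\<close>.\<close>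

definition resolvent_at ::
    "fseq set \<Rightarrow> (fseq \<Rightarrow> fseq \<Rightarrow> real) \<Rightarrow> real \<Rightarrow> fseq \<Rightarrow> fseq \<Rightarrow> bool" where
  "resolvent_at C \<phi> r x z \<longleftrightarrow>
     z \<in> C \<and> (\<forall>y\<in>C. \<phi> z y + (1 / r) * inner (y - z) (z - x) \<ge> 0)"

definition Omega :: "nat \<Rightarrow> fseq set \<Rightarrow> (nat \<Rightarrow> fseq \<Rightarrow> fseq \<Rightarrow> real) \<Rightarrow> fseq set" where
  "Omega N C f = (\<Inter>i\<in>{1..N}. Sol C (f i))"

definition setting ::
    "nat \<Rightarrow> nat \<Rightarrow> fseq set \<Rightarrow> (nat \<Rightarrow> fseq \<Rightarrow> fseq \<Rightarrow> real) \<Rightarrow> (nat \<Rightarrow> real) \<Rightarrow> bool" where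
  "setting n N C f \<alpha> \<longleftrightarrow>
     n \<ge> 1 \<and> N \<ge> 2 \<and> C \<subseteq> Rn n \<and> C \<noteq> {} \<and> closed C \<and> convex C \<and> Omega N C f \<noteq> {} \<and>
     (\<forall>i\<in>{1..N}. 0 < \<alpha> i \<and> \<alpha> i < 1) \<and> (\<Sum>i=1..N. \<alpha> i) = 1"

definition contractive :: "nat \<Rightarrow> real \<Rightarrow> (fseq \<Rightarrow> fseq) \<Rightarrow> bool" where
  "contractive n \<tau> F \<longleftrightarrow> 0 < \<tau> \<and> \<tau> < 1 \<and> F ` Rn n \<subseteq> Rn n \<and>
     (\<forall>x\<in>Rn n. \<forall>y\<in>Rn n. norm (F x - F y) \<le> \<tau> * norm (x - y))"

definition bounded_linear_operator :: "nat \<Rightarrow> (fseq \<Rightarrow> fseq) \<Rightarrow> bool" where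
  "bounded_linear_operator n A \<longleftrightarrow> A ` Rn n \<subseteq> Rn n \<and>
     (\<forall>x\<in>Rn n. \<forall>y\<in>Rn n. A (x + y) = A x + A y) \<and>
     (\<forall>c. \<forall>x\<in>Rn n. A (c *\<^sub>R x) = c *\<^sub>R A x) \<and>
     (\<exists>K. \<forall>x\<in>Rn n. norm (A x) \<le> K * norm x)"

definition strongly_positive :: "nat \<Rightarrow> real \<Rightarrow> (fseq \<Rightarrow> fseq) \<Rightarrow> bool" where
  "strongly_positive n \<gamma> A \<longleftrightarrow> 0 < \<gamma> \<and> (\<forall>x\<in>Rn n. inner (A x) x \<ge> \<gamma> * (norm x)\<^sup>2)"

text \<open>
  The sequences of the algorithms carry their original indices \<open>k \<ge> 1\<close>; entries at index \<open>0\<close> are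
  irrelevant, except for \<open>x 0\<close> in the fifth assertion.
\<close>

definition converges1 :: "(nat \<Rightarrow> real) \<Rightarrow> bool" where
  "converges1 a \<longleftrightarrow> summable (\<lambda>k. a (Suc k))"

definition diverges1 :: "(nat \<Rightarrow> real) \<Rightarrow> bool" where
  "diverges1 a \<longleftrightarrow> filterlim (\<lambda>m. \<Sum>k=1..m. a k) at_top sequentially"

definition in_unit :: "(nat \<Rightarrow> real) \<Rightarrow> bool" where
  "in_unit a \<longleftrightarrow> (\<forall>k\<ge>1. 0 < a k \<and> a k < 1)"

definition in_subinterval :: "(nat \<Rightarrow> real) \<Rightarrow> real \<Rightarrow> real \<Rightarrow> bool" where
  "in_subinterval \<rho> lo hi \<longleftrightarrow> (\<forall>k\<ge>1. \<rho> k \<in> {lo<..<hi}) \<and> {lo<..<hi} \<subseteq> {0<..<1}"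


section \<open>The five assertions\<close>

definition assertion1 :: bool where
  "assertion1 \<longleftrightarrow> (\<forall>n N C f \<alpha>.
     setting n N C f \<alpha> \<longrightarrow> (\<forall>i\<in>{1..N}. condA1_4 C (f i)) \<longrightarrow>
     Omega N C f = Sol C (comb N \<alpha> f))"

definition assertion2 :: bool where
  "assertion2 \<longleftrightarrow> (\<forall>n N C f \<alpha> \<tau> F \<gamma>' A \<gamma> \<delta> \<theta> \<rho> x y z \<theta>lo \<theta>hi \<alpha>lo \<alpha>hi.
     setting n N C f \<alpha> \<longrightarrow> (\<forall>i\<in>{1..N}. condA1_4 C (f i)) \<longrightarrow>
     contractive n \<tau> F \<longrightarrow>
     bounded_linear_operator n A \<longrightarrow> strongly_positive n \<gamma>' A \<longrightarrow>
     0 < \<gamma> \<longrightarrow> \<gamma> < \<gamma>' / \<tau> \<longrightarrow>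
     in_unit \<delta> \<longrightarrow> in_unit \<theta> \<longrightarrow> in_unit \<rho> \<longrightarrow>
     x 1 \<in> Rn n \<longrightarrow>
     (\<forall>k\<ge>1. resolvent_at C (comb N \<alpha> f) (\<rho> k) (x k) (z k) \<and>
        y k = \<theta> k *\<^sub>R metric_proj C (x k) + (1 - \<theta> k) *\<^sub>R z k \<and>
        x (k + 1) = (\<delta> k * \<gamma>) *\<^sub>R F (x k) + (y k - \<delta> k *\<^sub>R A (y k))) \<longrightarrow>
     \<delta> \<longlonglongrightarrow> 0 \<longrightarrow> diverges1 \<delta> \<longrightarrow>
     0 < \<theta>lo \<longrightarrow> \<theta>hi < 1 \<longrightarrow> (\<forall>k\<ge>1. \<theta>lo \<le> \<theta> k \<and> \<theta> k \<le> \<theta>hi) \<longrightarrow>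
     0 < \<alpha>lo \<longrightarrow> \<alpha>hi < 1 \<longrightarrow> (\<forall>i\<in>{1..N}. \<alpha>lo \<le> \<alpha> i \<and> \<alpha> i \<le> \<alpha>hi) \<longrightarrow>
     (\<Sum>i=1..N. \<alpha> i) = 1 \<longrightarrow>
     converges1 (\<lambda>k. \<bar>\<delta> (k + 1) - \<delta> k\<bar>) \<longrightarrow>
     converges1 (\<lambda>k. \<bar>\<theta> (k + 1) - \<theta> k\<bar>) \<longrightarrow>
     converges1 (\<lambda>k. \<bar>\<rho> (k + 1) - \<rho> k\<bar>) \<longrightarrow>
     (\<exists>q\<in>Rn n. q = metric_proj (Omega N C f) (q - A q + \<gamma> *\<^sub>R F q) \<and>
        x \<longlonglongrightarrow> q \<and> y \<longlonglongrightarrow> q \<and> z \<longlonglongrightarrow> q))"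

definition assertion3 :: bool where
  "assertion3 \<longleftrightarrow> (\<forall>n N C f \<alpha> u l \<mu> \<delta> \<rho> \<rho>lo \<rho>hi x y.
     setting n N C f \<alpha> \<longrightarrow> (\<forall>i\<in>{1..N}. condA1_4 C (f i)) \<longrightarrow>
     in_unit l \<longrightarrow> in_unit \<mu> \<longrightarrow> in_unit \<delta> \<longrightarrow>
     (\<forall>k\<ge>1. l k + \<mu> k + \<delta> k = 1) \<longrightarrow>
     in_subinterval \<rho> \<rho>lo \<rho>hi \<longrightarrow>
     u \<in> Rn n \<longrightarrow> x 1 \<in> Rn n \<longrightarrow>
     (\<forall>k\<ge>1. resolvent_at C (comb N \<alpha> f) (\<rho> k) (x k) (y k) \<and>
        x (k + 1) = l k *\<^sub>R u + \<mu> k *\<^sub>R x k + \<delta> k *\<^sub>R y k) \<longrightarrow>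
     l \<longlonglongrightarrow> 0 \<longrightarrow> diverges1 l \<longrightarrow>
     (\<Sum>i=1..N. \<alpha> i) = 1 \<longrightarrow>
     converges1 (\<lambda>k. \<bar>\<delta> (k + 1) - \<delta> k\<bar>) \<longrightarrow>
     x \<longlonglongrightarrow> metric_proj (Omega N C f) u \<and> y \<longlonglongrightarrow> metric_proj (Omega N C f) u)"

text \<open>
  In the last two assertions the source leaves the point \<open>u\<close> in the limit unspecified.  We
  quantify it existentially, after all the data: this is the weakest reading of the conclusion, so
  that its refutation refutes the assertion for every choice of \<open>u\<close>.
\<close>

definition assertion4 :: bool where
  "assertion4 \<longleftrightarrow> (\<forall>n N C f \<alpha> \<tau> F l \<mu> \<delta> \<rho> \<rho>lo \<rho>hi x y.
     setting n N C f \<alpha> \<longrightarrow> (\<forall>i\<in>{1..N}. condA1_4 C (f i)) \<longrightarrow>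
     contractive n \<tau> F \<longrightarrow>
     in_unit l \<longrightarrow> in_unit \<mu> \<longrightarrow> in_unit \<delta> \<longrightarrow>
     in_subinterval \<rho> \<rho>lo \<rho>hi \<longrightarrow>
     x 1 \<in> C \<longrightarrow>
     (\<forall>k\<ge>1. resolvent_at C (comb N \<alpha> f) (\<rho> k) (x k) (y k) \<and>
        x (k + 1) = l k *\<^sub>R F (x k) + \<mu> k *\<^sub>R x k + \<delta> k *\<^sub>R y k) \<longrightarrow>
     l \<longlonglongrightarrow> 0 \<longrightarrow> diverges1 l \<longrightarrow>
     (\<Sum>i=1..N. \<alpha> i) = 1 \<longrightarrow>
     converges1 (\<lambda>k. \<bar>\<rho> (k + 1) - \<rho> k\<bar>) \<longrightarrow>
     (\<exists>u\<in>Rn n. x \<longlonglongrightarrow> metric_proj (Omega N C f) u \<and> y \<longlonglongrightarrow> metric_proj (Omega N C f) u))"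

text \<open>
  The source imposes \<open>\<Sum>\<^sub>i \<alpha>\<^sub>i < \<infinity>\<close> and \<open>\<alpha>\<^sub>i \<rightarrow> 0\<close> although only \<open>\<alpha>\<^sub>1, \<dots>, \<alpha>\<^sub>N\<close> have been introduced.
  Here \<open>\<alpha>\<close> is a sequence, unconstrained beyond \<open>N\<close> except by these two conditions; its terms
  beyond \<open>N\<close> enter nowhere else.
\<close>

definition assertion5 :: bool where
  "assertion5 \<longleftrightarrow> (\<forall>n N C f \<alpha> \<theta>' \<theta> l \<mu> \<rho> \<rho>lo \<rho>hi x y z.
     setting n N C f \<alpha> \<longrightarrow> (\<forall>i\<in>{1..N}. condA1_4 C (f i) \<and> condA5 n C (f i)) \<longrightarrow>
     0 \<le> \<theta>' \<longrightarrow> \<theta>' \<le> 1 \<longrightarrow> (\<forall>k\<ge>1. 0 \<le> \<theta> k \<and> \<theta> k \<le> \<theta>') \<longrightarrow>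
     in_unit l \<longrightarrow> in_unit \<mu> \<longrightarrow> (\<forall>k\<ge>1. l k + \<mu> k = 1) \<longrightarrow>
     in_subinterval \<rho> \<rho>lo \<rho>hi \<longrightarrow>
     x 0 \<in> Rn n \<longrightarrow> x 1 \<in> Rn n \<longrightarrow>
     (\<forall>k\<ge>1. y k = x k + \<theta> k *\<^sub>R (x k - x (k - 1)) \<and>
        resolvent_at C (comb N \<alpha> f) (\<rho> k) (y k) (z k) \<and>
        x (k + 1) = l k *\<^sub>R x k + \<mu> k *\<^sub>R z k) \<longrightarrow>
     converges1 (\<lambda>k. \<theta> k * norm (x k - x (k - 1))) \<longrightarrow>
     converges1 \<alpha> \<longrightarrow> \<alpha> \<longlonglongrightarrow> 0 \<longrightarrow>
     converges1 (\<lambda>k. \<bar>\<rho> (k + 1) - \<rho> k\<bar>) \<longrightarrow>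
     converges1 (\<lambda>k. \<bar>l (k + 1) - l k\<bar>) \<longrightarrow>
     (\<exists>u\<in>Rn n. x \<longlonglongrightarrow> metric_proj (Omega N C f) u))"

end

theory Submission
  imports Defs
begin

text \<open>
  Monotonicity allows a bifunction and its negative at the same time: any skew form, such as the
  oriented area \<open>x\<^sub>0 y\<^sub>1 - x\<^sub>1 y\<^sub>0\<close> in the plane, has this property together with all the other
  conditions.  So let \<open>f\<^sub>1\<close> be the negative of \<open>f\<^sub>2\<close>, with \<open>f\<^sub>2\<close> the area form, and put
  \<open>\<alpha>\<^sub>1 = \<alpha>\<^sub>2 = 1/2\<close>.  The combination vanishes identically, so every point of \<open>C\<close> is an equilibrium
  of it, whereas \<open>0\<close> is the only equilibrium of either form when \<open>C\<close> is a plane set that surrounds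
  the origin (\<open>Omega_square\<close>).  This refutes the first assertion.

  For the four algorithms, cancellation turns the regularised problem into the metric projection
  onto \<open>C\<close>, which fixes the points of \<open>C\<close> (\<open>resolvent_comb\<close>).  The algorithms thus have no way of
  seeing \<open>\<Omega>\<close>: with the anchor, if there is one (the point \<open>u\<close>, or the value of a constant
  contraction \<open>F\<close>), placed at a nonzero point of \<open>C\<close>, the sequences that are constantly equal to that point are admissible,
  and they do not converge to \<open>0\<close>, the only possible value of \<open>P\<^sub>\<Omega>\<close>.  For \<open>C\<close> the square spanned by
  the four signed unit vectors of the plane is taken: a compact set makes the coercivity condition
  of the last assertion trivial.
\<close>

section \<open>The oriented area form\<close>

definition unit_vec :: "nat \<Rightarrow> fseq" where
  "unit_vec i = Abs_fseq (\<lambda>j. if j = i then 1 else 0)"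

lemma coord_unit_vec [simp]: "coord (unit_vec i) j = (if j = i then 1 else 0)"
  by (simp add: unit_vec_def Abs_fseq_inverse)

lemma inner_unit_vec: "inner (unit_vec i) x = coord x i"
  by (subst inner_fseq_superset[of "{i}"]) auto

definition area :: "fseq \<Rightarrow> fseq \<Rightarrow> real" where
  "area x y = coord x 0 * coord y 1 - coord x 1 * coord y 0"

lemma lsc_on_continuous:
  assumes "continuous_on C g"
  shows "lsc_on C g"
  unfolding lsc_on_def
proof
  fix y assume "y \<in> C"
  \<comment> \<open>At an isolated point of \<open>C\<close> the filter is trivial and the lower limit is \<open>\<infinity>\<close>.\<close>
  show "ereal (g y) \<le> Liminf (at y within C) (\<lambda>w. ereal (g w))"
  proof (cases "at y within C = bot")
    case False
    have "(g \<longlongrightarrow> g y) (at y within C)"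
      using assms \<open>y \<in> C\<close> by (simp add: continuous_on_def)
    then have "((\<lambda>w. ereal (g w)) \<longlongrightarrow> ereal (g y)) (at y within C)"
      by simp
    from lim_imp_Liminf[OF False this] show ?thesis
      by simp
  qed simp
qed

text \<open>
  The sign of \<open>s\<close> is free because a skew form is monotone with equality; both signs are used.
\<close>

lemma condA1_4_area:
  assumes "convex C"
  shows "condA1_4 C (\<lambda>x y. s * area x y)"
proof -
  have "condA3 C (\<lambda>x y. s * area x y)"
    unfolding condA3_def
  proof (intro ballI)
    fix x y z
    have "((\<lambda>t. s * area (t *\<^sub>R z + (1 - t) *\<^sub>R x) y) \<longlongrightarrow> s * area (0 *\<^sub>R z + (1 - 0) *\<^sub>R x) y)
        (at_right 0)"
      unfolding area_def coord_simps by (intro tendsto_intros)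
    then have "((\<lambda>t. ereal (s * area (t *\<^sub>R z + (1 - t) *\<^sub>R x) y)) \<longlongrightarrow> ereal (s * area x y))
        (at_right 0)"
      by simp
    from lim_imp_Limsup[OF trivial_limit_at_right_real this]
    show "Limsup (at_right 0) (\<lambda>t. ereal (s * area (t *\<^sub>R z + (1 - t) *\<^sub>R x) y))
        \<le> ereal (s * area x y)"
      by simp
  qed
  moreover have "condA4 C (\<lambda>x y. s * area x y)"
    unfolding condA4_def
  proof (intro ballI conjI)
    fix x
    show "lsc_on C (\<lambda>y. s * area x y)"
      unfolding area_def inner_unit_vec[symmetric]
      by (intro lsc_on_continuous continuous_intros)
    show "convex_on C (\<lambda>y. s * area x y)"
      by (rule convex_onI) (use assms in \<open>simp_all add: area_def algebra_simps\<close>)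
  qed
  ultimately show ?thesis
    by (simp add: condA1_4_def condA1_def condA2_def area_def algebra_simps)
qed

section \<open>A square around the origin\<close>

definition square :: "fseq set" where
  "square = convex hull {unit_vec 0, - unit_vec 0, unit_vec 1, - unit_vec 1}"

lemma vertices_in_square:
  "unit_vec 0 \<in> square" "- unit_vec 0 \<in> square" "unit_vec 1 \<in> square" "- unit_vec 1 \<in> square"
  unfolding square_def by (simp_all add: hull_inc)

lemma convex_square: "convex square"
  by (simp add: square_def)

lemma compact_square: "compact square"
  by (simp add: square_def finite_imp_compact_convex_hull)

lemma square_subset_Rn: "square \<subseteq> Rn 2"
  unfolding square_def
  by (rule hull_minimal) (auto simp: subspace_imp_convex subspace_Rn, auto simp: Rn_def)

lemma zero_in_square: "0 \<in> square"
  using convexD[OF convex_square vertices_in_square(1,2), of "1/2" "1/2"] by simp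

text \<open>Testing against the four vertices forces both coordinates of an equilibrium to vanish.\<close>

lemma Sol_square_area:
  assumes "s \<noteq> 0"
  shows "Sol square (\<lambda>x y. s * area x y) = {0}"
proof -
  have "x = 0" if "x \<in> square" and sol: "\<And>y. y \<in> square \<Longrightarrow> 0 \<le> s * area x y" for x
  proof (rule fseq_eqI)
    have "s * coord x 0 = 0" "s * coord x 1 = 0"
      using vertices_in_square[THEN sol] by (simp_all add: area_def)
    moreover have "coord x i = 0" if "i \<ge> 2" for i
      using \<open>x \<in> square\<close> square_subset_Rn that by (auto simp: Rn_def)
    ultimately show "coord x i = coord 0 i" for i
      using assms by (cases "i \<ge> 2") (auto simp: not_le less_2_cases_iff)
  qed
  then show ?thesis
    by (auto simp: Sol_def zero_in_square area_def)
qed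

section \<open>The cancelling pair\<close>

definition skew_pair :: "nat \<Rightarrow> fseq \<Rightarrow> fseq \<Rightarrow> real" where
  "skew_pair i x y = (-1) ^ i * area x y"

text \<open>
  The weights are continued by \<open>0\<close> to a sequence, so that the summability condition of the fifth
  assertion holds for them.
\<close>

definition half_weights :: "nat \<Rightarrow> real" where
  "half_weights i = (if i \<in> {1..2} then 1/2 else 0)"

lemma condA1_4_skew_pair: "condA1_4 square (skew_pair i)"
  using condA1_4_area[OF convex_square, of "(-1) ^ i"] by (simp add: skew_pair_def[abs_def])

text \<open>As the square is compact, it serves as the set \<open>B\<close> itself.\<close>

lemma condA5_square: "condA5 2 square \<phi>"
  unfolding condA5_def
  by (intro allI impI ballI exI[of _ square])
    (use zero_in_square square_subset_Rn compact_square convex_square in auto)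

lemma Omega_square: "Omega 2 square skew_pair = {0}"
  using Sol_square_area[of "(-1) ^ _"] by (simp add: Omega_def skew_pair_def[abs_def])

lemma comb_skew_pair: "comb 2 half_weights skew_pair = (\<lambda>x y. 0)"
  by (simp add: fun_eq_iff comb_def skew_pair_def half_weights_def numeral_2_eq_2)

lemma sum_half_weights: "(\<Sum>i=1..2. half_weights i) = 1"
  by (simp add: half_weights_def numeral_2_eq_2)

lemma setting_square: "setting 2 2 square skew_pair half_weights"
  using square_subset_Rn zero_in_square convex_square compact_imp_closed[OF compact_square]
    sum_half_weights
  by (auto simp: setting_def Omega_square half_weights_def)

lemma half_weights_summable: "converges1 half_weights"
  unfolding converges1_def
  by (rule summable_finite[of "{..2}"]) (auto simp: half_weights_def)

lemma half_weights_tendsto_zero: "half_weights \<longlonglongrightarrow> 0"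
  using half_weights_summable unfolding converges1_def
  by (auto dest: summable_LIMSEQ_zero simp: filterlim_sequentially_Suc)

text \<open>
  For the zero bifunction the regularised problem is the variational inequality that characterises
  the metric projection, whatever the parameter \<open>r\<close>; a point of the square is its own projection.
\<close>

lemma resolvent_comb:
  "p \<in> square \<Longrightarrow> resolvent_at square (comb 2 half_weights skew_pair) r p p"
  by (simp add: resolvent_at_def comb_skew_pair)

lemma metric_proj_fixes: "p \<in> K \<Longrightarrow> metric_proj K p = p"
  unfolding metric_proj_def by (rule the_equality) auto

lemma metric_proj_Omega: "metric_proj (Omega 2 square skew_pair) u = 0"
  unfolding metric_proj_def Omega_square by (rule the_equality) auto

lemma unit_vec_nonzero: "unit_vec i \<noteq> 0"
  by (metis coord_simps(1) coord_unit_vec zero_neq_one)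

lemma const_not_tendsto_zero: "\<not> (\<lambda>k::nat. unit_vec 0) \<longlonglongrightarrow> 0"
  using LIMSEQ_unique[OF tendsto_const] unit_vec_nonzero by metis

lemma unit_vec_in_Rn: "unit_vec 0 \<in> Rn 2"
  using vertices_in_square(1) square_subset_Rn by blast

section \<open>Admissible parameters\<close>

text \<open>
  The factor \<open>1/4\<close> leaves room for two further weights in \<open>(0,1)\<close> that complete it to \<open>1\<close>, one of
  them constantly \<open>1/4\<close>.
\<close>

definition step :: "nat \<Rightarrow> real" where
  "step k = inverse (of_nat k) / 4"

lemma step_bounds: "k \<ge> 1 \<Longrightarrow> 0 < step k \<and> step k \<le> 1/4"
  by (simp add: step_def inverse_le_1_iff)

lemma step_tendsto_zero: "step \<longlonglongrightarrow> 0"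
  unfolding step_def[abs_def] by (rule tendsto_divide_zero[OF lim_inverse_n])

lemma diverges_step: "diverges1 step"
proof -
  have "(\<Sum>k=1..m. step k) = 1/4 * harm m" for m
    by (simp add: step_def harm_def sum_divide_distrib)
  moreover have "filterlim (\<lambda>m. 1/4 * (harm m :: real)) at_top sequentially"
    by (rule filterlim_tendsto_pos_mult_at_top[OF tendsto_const _ harm_at_top]) simp
  ultimately show ?thesis
    by (simp only: diverges1_def)
qed

text \<open>The increments of a decreasing sequence have one sign, so their sum telescopes.\<close>

lemma step_bounded_variation: "converges1 (\<lambda>k. \<bar>step (k + 1) - step k\<bar>)"
proof -
  have "step (Suc (Suc k)) \<le> step (Suc k)" for k
    by (simp add: step_def)
  then have "\<bar>step (Suc k + 1) - step (Suc k)\<bar> = step (Suc k) - step (Suc (Suc k))" for k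
    by simp
  moreover have "summable (\<lambda>k. step (Suc k) - step (Suc (Suc k)))"
    by (rule telescope_summable') (use LIMSEQ_Suc[OF step_tendsto_zero] in simp)
  ultimately show ?thesis
    by (simp add: converges1_def)
qed

lemma contractive_const: "p \<in> Rn n \<Longrightarrow> contractive n (1/2) (\<lambda>_. p)"
  by (auto simp: contractive_def)

lemma identity_operator: "bounded_linear_operator n id" "strongly_positive n 1 id"
  by (auto simp: bounded_linear_operator_def strongly_positive_def power2_norm_eq_inner
      intro: exI[of _ 1])

section \<open>Refuting the assertions\<close>

lemma not_assertion1: "\<not> assertion1"
proof
  assume assertion1
  then have "Omega 2 square skew_pair = Sol square (comb 2 half_weights skew_pair)"
    using setting_square condA1_4_skew_pair unfolding assertion1_def by blast
  then have "square = {0}"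
    by (simp add: Omega_square comb_skew_pair Sol_def)
  then show False
    using vertices_in_square(1) unit_vec_nonzero by blast
qed

text \<open>
  With \<open>A\<close> the identity and \<open>\<gamma> = 1\<close>, the iteration moves along the segment from the projection of
  \<open>x\<^sup>k\<close> to the anchor; it stays where it is when both coincide.
\<close>

lemma not_assertion2: "\<not> assertion2"
proof
  let ?e = "unit_vec 0"
  assume *: assertion2
  have "\<exists>q\<in>Rn 2. q = metric_proj (Omega 2 square skew_pair) (q - id q + 1 *\<^sub>R ?e) \<and>
      (\<lambda>k::nat. ?e) \<longlonglongrightarrow> q \<and> (\<lambda>k::nat. ?e) \<longlonglongrightarrow> q \<and> (\<lambda>k::nat. ?e) \<longlonglongrightarrow> q"
    by (rule *[unfolded assertion2_def, rule_format, where n = 2 and N = 2 and C = square and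
          f = skew_pair and \<alpha> = half_weights and \<tau> = "1/2" and F = "\<lambda>_. ?e" and \<gamma>' = 1 and
          A = id and x = "\<lambda>_. ?e" and y = "\<lambda>_. ?e" and z = "\<lambda>_. ?e" and
          \<delta> = step and \<theta> = "\<lambda>_. 1/2" and \<rho> = "\<lambda>_. 1/2" and \<theta>lo = "1/2" and \<theta>hi = "1/2" and
          \<alpha>lo = "1/2" and \<alpha>hi = "1/2"])
      (use setting_square condA1_4_skew_pair step_bounds step_tendsto_zero diverges_step
        step_bounded_variation unit_vec_in_Rn contractive_const[OF unit_vec_in_Rn]
        identity_operator resolvent_comb[OF vertices_in_square(1)] sum_half_weights
        metric_proj_fixes[OF vertices_in_square(1)] in
        \<open>fastforce simp: in_unit_def converges1_def half_weights_def
          scaleR_add_left[symmetric]\<close>)+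
  then show False
    using const_not_tendsto_zero by (auto simp: metric_proj_Omega)
qed

lemma not_assertion3: "\<not> assertion3"
proof
  let ?e = "unit_vec 0"
  assume *: assertion3
  have "(\<lambda>k::nat. ?e) \<longlonglongrightarrow> metric_proj (Omega 2 square skew_pair) ?e \<and>
      (\<lambda>k::nat. ?e) \<longlonglongrightarrow> metric_proj (Omega 2 square skew_pair) ?e"
    by (rule *[unfolded assertion3_def, rule_format, where n = 2 and N = 2 and C = square and
          f = skew_pair and \<alpha> = half_weights and u = ?e and x = "\<lambda>_. ?e" and y = "\<lambda>_. ?e" and
          l = step and \<mu> = "\<lambda>k. 3/4 - step k" and \<delta> = "\<lambda>_. 1/4" and
          \<rho> = "\<lambda>_. 1/2" and \<rho>lo = "1/4" and \<rho>hi = "3/4"])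
      (use setting_square condA1_4_skew_pair step_bounds step_tendsto_zero diverges_step
        unit_vec_in_Rn resolvent_comb[OF vertices_in_square(1)] sum_half_weights in
        \<open>fastforce simp: in_unit_def in_subinterval_def converges1_def
          scaleR_add_left[symmetric]\<close>)+
  then show False
    using const_not_tendsto_zero by (simp add: metric_proj_Omega)
qed

lemma not_assertion4: "\<not> assertion4"
proof
  let ?e = "unit_vec 0"
  assume *: assertion4
  have "\<exists>u\<in>Rn 2. (\<lambda>k::nat. ?e) \<longlonglongrightarrow> metric_proj (Omega 2 square skew_pair) u \<and>
      (\<lambda>k::nat. ?e) \<longlonglongrightarrow> metric_proj (Omega 2 square skew_pair) u"
    by (rule *[unfolded assertion4_def, rule_format, where n = 2 and N = 2 and C = square and
          f = skew_pair and \<alpha> = half_weights and \<tau> = "1/2" and F = "\<lambda>_. ?e" and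
          x = "\<lambda>_. ?e" and y = "\<lambda>_. ?e" and
          l = step and \<mu> = "\<lambda>k. 3/4 - step k" and \<delta> = "\<lambda>_. 1/4" and
          \<rho> = "\<lambda>_. 1/2" and \<rho>lo = "1/4" and \<rho>hi = "3/4"])
      (use setting_square condA1_4_skew_pair step_bounds step_tendsto_zero diverges_step
        contractive_const[OF unit_vec_in_Rn] vertices_in_square(1)
        resolvent_comb[OF vertices_in_square(1)] sum_half_weights in
        \<open>fastforce simp: in_unit_def in_subinterval_def converges1_def
          scaleR_add_left[symmetric]\<close>)+
  then show False
    using const_not_tendsto_zero by (simp add: metric_proj_Omega)
qed

text \<open>
  There is no anchor here: starting with \<open>x\<^sup>0 = x\<^sup>1\<close> kills the inertial term, and the iteration stays
  at its starting point.
\<close>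

lemma not_assertion5: "\<not> assertion5"
proof
  let ?e = "unit_vec 0"
  assume *: assertion5
  have "\<exists>u\<in>Rn 2. (\<lambda>k::nat. ?e) \<longlonglongrightarrow> metric_proj (Omega 2 square skew_pair) u"
    by (rule *[unfolded assertion5_def, rule_format, where n = 2 and N = 2 and C = square and
          f = skew_pair and \<alpha> = half_weights and x = "\<lambda>_. ?e" and y = "\<lambda>_. ?e" and
          z = "\<lambda>_. ?e" and \<theta>' = 1 and \<theta> = "\<lambda>_. 1" and
          l = "\<lambda>_. 1/2" and \<mu> = "\<lambda>_. 1/2" and
          \<rho> = "\<lambda>_. 1/2" and \<rho>lo = "1/4" and \<rho>hi = "3/4"])
      (use setting_square condA1_4_skew_pair condA5_square half_weights_summable
        half_weights_tendsto_zero unit_vec_in_Rn resolvent_comb[OF vertices_in_square(1)] in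
        \<open>fastforce simp: in_unit_def in_subinterval_def converges1_def
          scaleR_add_left[symmetric]\<close>)+
  then show False
    using const_not_tendsto_zero by (simp add: metric_proj_Omega)
qed

theorem corollary3p1:
  shows "\<not> assertion1 \<and> \<not> assertion2 \<and> \<not> assertion3 \<and> \<not> assertion4 \<and> \<not> assertion5"
  using not_assertion1 not_assertion2 not_assertion3 not_assertion4 not_assertion5 by blast

end
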